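(* Let $X$ be a normed space, let $\{x_t\}_{t\in\mathbb{N}}$ be a sequence in $X$, let $\{\omega_t\}_{t\in\mathbb{N}}$ be a weighted sequence, let $\mathcal{I}$ be an ideal on $\mathbb{N}$, and let $r\ge0$. Then $$\operatorname{diam}\big((\omega_t,\mathcal{I})\text{-}\mathrm{LIM}^r x_t\big)\le\frac{2r}{\liminf_{t\in\mathbb{N}}\omega_t}.$$
   Context: A sequence $\{\omega_t\}_{t\in\mathbb{N}}$ of real numbers is a weighted sequence if there is $\beta>0$ with $\omega_t>\beta$ for all $t\in\mathbb{N}$. An ideal on $\mathbb{N}$ is a family $\mathcal{I}\subseteq\mathcal{P}(\mathbb{N})$ with $\varnothing\in\mathcal{I}$, closed under finite unions and under taking subsets. For $r\ge0$, $(\omega_t,\mathcal{I})\text{-}\mathrm{LIM}^r x_t$ is the set of all $x_*\in X$ such that $\{t\in\mathbb{N}:\omega_t\|x_t-x_*\|>r+\varepsilon\}\in\mathcal{I}$ for every $\varepsilon>0$. Here $\liminf_{t\in\mathbb{N}}\omega_t$ is the usual limit inferior as $t\to\infty$, and $\operatorname{diam}$ denotes the diameter with respect to the norm of $X$.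
   Formalization: The ideal is additionally assumed to contain no set with finite complement (automatic for a proper ideal containing all finite sets); without this the bound fails, e.g. if the ideal is all of P(N), the limit set is X, which is unbounded for X = R. *)

theory Defs
  imports "HOL-Analysis.Analysis"
begin

definition weighted_seq :: "(nat \<Rightarrow> real) \<Rightarrow> bool" where
  "weighted_seq \<omega> \<longleftrightarrow> (\<exists>\<beta>>0. \<forall>t. \<omega> t > \<beta>)"

text \<open>Neither properness (\<open>UNIV \<notin> I\<close>) nor admissibility (every finite set lies in \<open>I\<close>)
  is part of the definition.\<close>

definition set_ideal :: "nat set set \<Rightarrow> bool" where
  "set_ideal I \<longleftrightarrow> {} \<in> I \<and> (\<forall>A\<in>I. \<forall>B\<in>I. A \<union> B \<in> I) \<and> (\<forall>A\<in>I. \<forall>B. B \<subseteq> A \<longrightarrow> B \<in> I)"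

definition rough_weighted_LIM ::
  "(nat \<Rightarrow> real) \<Rightarrow> nat set set \<Rightarrow> real \<Rightarrow> (nat \<Rightarrow> 'a::real_normed_vector) \<Rightarrow> 'a set" where
  "rough_weighted_LIM \<omega> I r x =
    {x'. \<forall>\<epsilon>>0. {t. \<omega> t * norm (x t - x') > r + \<epsilon>} \<in> I}"

text \<open>The diameter bound fails for an ideal with a cofinite member: only finitely many of the
  weights then constrain the limit set, whereas \<open>liminf\<close> ignores them. Proper ideals containing
  all finite sets have no such member.\<close>

lemma proper_admissible_imp_infinite_Compl:
  assumes "set_ideal I" "UNIV \<notin> I" "\<And>F. finite F \<Longrightarrow> F \<in> I" "A \<in> I"
  shows "infinite (- A)"
  using assms unfolding set_ideal_def by (metis Compl_partition)

text \<open>The real-valued \<open>diameter\<close> carries no information on unbounded sets, so a bound on the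
  extended-valued diameter of \<open>S\<close> is stated as \<open>bounded S\<close> together with a bound on
  \<open>diameter S\<close>; note that \<open>diameter {} = 0\<close>. The limit inferior is taken in \<open>ereal\<close>
  since weights may tend to infinity, where \<open>a / \<infinity> = 0\<close> for real \<open>a\<close>.\<close>

end

theory Submission
  imports Defs
begin

text \<open>If \<open>y\<close> and \<open>z\<close> are both rough weighted limits, then outside a member of the ideal
  \<open>\<omega> t * norm (y - z) \<le> 2 * (r + \<epsilon>)\<close>, by the triangle inequality through \<open>x t\<close>. The complement of
  that member is infinite, so it meets every tail of \<open>\<nat>\<close>; in particular it contains an index
  at which \<open>\<omega> t > c\<close>, for any real \<open>c \<ge> 0\<close> below the limit inferior of the weights. Hence
  \<open>c * norm (y - z) \<le> 2 * r\<close> for all such \<open>c\<close>, and letting \<open>c\<close> increase to the limit inferior,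
  which is positive and possibly infinite, gives the bound.\<close>

lemma weighted_seq_liminf_pos:
  assumes "weighted_seq \<omega>"
  shows "0 < liminf (\<lambda>t. ereal (\<omega> t))"
proof -
  obtain \<beta> where \<beta>: "\<beta> > 0" "\<And>t. \<omega> t > \<beta>"
    using assms unfolding weighted_seq_def by blast
  have "ereal \<beta> \<le> liminf (\<lambda>t. ereal (\<omega> t))"
    using \<beta>(2) by (intro Liminf_bounded always_eventually) (simp add: less_imp_le)
  moreover have "0 < ereal \<beta>"
    using \<beta>(1) by simp
  ultimately show ?thesis
    by (rule less_le_trans[rotated])
qed

text \<open>Some single index \<open>t\<close> both satisfies \<open>\<omega> t > c\<close> and is exceptional for neither limit
  point: the first condition holds on a tail, the second on an infinite set. At that \<open>t\<close> the
  points lie within \<open>(r + \<epsilon>) / \<omega> t\<close> of \<open>x t\<close>.\<close>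

lemma rough_weighted_LIM_dist_le:
  fixes x :: "nat \<Rightarrow> 'a::real_normed_vector"
  assumes "set_ideal I"
    and inf: "\<And>A. A \<in> I \<Longrightarrow> infinite (- A)"
    and c: "0 \<le> c" "ereal c < liminf (\<lambda>t. ereal (\<omega> t))"
    and yz: "y \<in> rough_weighted_LIM \<omega> I r x" "z \<in> rough_weighted_LIM \<omega> I r x"
  shows "c * norm (y - z) \<le> 2 * r"
proof (rule field_le_epsilon)
  fix e :: real
  assume "e > 0"
  define B where "B w = {t. \<omega> t * norm (x t - w) > r + e / 2}" for w
  have "B y \<in> I" "B z \<in> I"
    using yz \<open>e > 0\<close> unfolding rough_weighted_LIM_def B_def by auto
  then have "B y \<union> B z \<in> I"
    using assms(1) unfolding set_ideal_def by blast
  then have "infinite (- (B y \<union> B z))"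
    by (rule inf)
  moreover have "eventually (\<lambda>t. ereal c < ereal (\<omega> t)) sequentially"
    using c(2) by (rule less_LiminfD)
  then obtain N where N: "\<And>t. t \<ge> N \<Longrightarrow> c < \<omega> t"
    unfolding eventually_sequentially by auto
  ultimately obtain t where t: "t \<ge> N" "t \<notin> B y" "t \<notin> B z"
    unfolding infinite_nat_iff_unbounded_le by blast
  have "norm (y - z) \<le> norm (x t - y) + norm (x t - z)"
    using norm_triangle_ineq4[of "x t - z" "x t - y"] by simp
  then have "c * norm (y - z) \<le> \<omega> t * (norm (x t - y) + norm (x t - z))"
    using N[OF t(1)] c(1) by (intro mult_mono) auto
  also have "\<dots> \<le> 2 * r + e"
    using t(2,3) by (simp add: B_def distrib_left)
  finally show "c * norm (y - z) \<le> 2 * r + e" .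
qed

text \<open>This is the passage to the limit in \<open>c\<close>. For finite \<open>L\<close> it is continuity of multiplication;
  for \<open>L = \<infinity>\<close> the quotient is \<open>0\<close>, and a positive \<open>d\<close> would have unboundedly large
  multiples below \<open>a\<close>.\<close>

lemma ereal_le_divide_approx:
  fixes d a :: real and L :: ereal
  assumes "0 < L" and le: "\<And>c. 0 < c \<Longrightarrow> ereal c < L \<Longrightarrow> c * d \<le> a"
  shows "ereal d \<le> ereal a / L"
proof (cases L)
  case (real l)
  with assms(1) have "l > 0" by simp
  have "d * l \<le> a"
  proof (rule tendsto_upperbound)
    show "((\<lambda>c. d * c) \<longlongrightarrow> d * l) (at_left l)"
      by (intro tendsto_intros)
    show "\<forall>\<^sub>F c in at_left l. d * c \<le> a"
      using eventually_at_left_real[OF \<open>l > 0\<close>]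
      by eventually_elim (use le real in \<open>auto simp: mult.commute\<close>)
  qed simp
  with real \<open>l > 0\<close> show ?thesis
    by (simp add: pos_le_divide_eq)
next
  case PInf
  have "d \<le> 0"
  proof (rule ccontr)
    assume "\<not> d \<le> 0"
    then have "d > 0" by simp
    have "(\<bar>a\<bar> + 1) / d * d \<le> a"
      using \<open>d > 0\<close> PInf by (intro le) auto
    with \<open>d > 0\<close> show False by simp
  qed
  with PInf show ?thesis by simp
qed (use assms(1) in simp)

theorem lemma2p3:
  fixes x :: "nat \<Rightarrow> 'a::real_normed_vector"
    and \<omega> :: "nat \<Rightarrow> real"
    and I :: "nat set set"
    and r :: real
  assumes "weighted_seq \<omega>"
    and "set_ideal I"
    and "\<And>A. A \<in> I \<Longrightarrow> infinite (- A)"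
    and "r \<ge> 0"
  shows "bounded (rough_weighted_LIM \<omega> I r x) \<and>
    ereal (diameter (rough_weighted_LIM \<omega> I r x)) \<le> ereal (2 * r) / liminf (\<lambda>t. ereal (\<omega> t))"
proof
  let ?S = "rough_weighted_LIM \<omega> I r x" and ?L = "liminf (\<lambda>t. ereal (\<omega> t))"
  have pos: "0 < ?L"
    using assms(1) by (rule weighted_seq_liminf_pos)
  have dist_le: "norm (y - z) \<le> 2 * r / c"
    if "0 < c" "ereal c < ?L" "y \<in> ?S" "z \<in> ?S" for c y z
    using rough_weighted_LIM_dist_le[OF assms(2,3) _ that(2-4)] that(1)
    by (simp add: pos_le_divide_eq mult.commute)
  obtain c where c: "0 < c" "ereal c < ?L"
    using ereal_dense2[OF pos] by auto
  show "bounded ?S"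
    using dist_le[OF c] unfolding bounded_two_points dist_norm by blast
  show "ereal (diameter ?S) \<le> ereal (2 * r) / ?L"
  proof (rule ereal_le_divide_approx[OF pos])
    fix c
    assume c: "0 < c" "ereal c < ?L"
    have "diameter ?S \<le> 2 * r / c"
      using dist_le[OF c] c(1) assms(4) by (intro diameter_le) auto
    with c(1) show "c * diameter ?S \<le> 2 * r"
      by (simp add: pos_le_divide_eq mult.commute)
  qed
qed

end
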